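(* Let $\mathcal{H}=\mathcal{H}(m,n,\mathcal{X},f)$ be the side information hypergraph of an instance of the index coding with side information (ICSI) problem, let $\delta\ge0$ be an integer, and let $\boldsymbol{L}$ be an $n\times N$ matrix over $\mathbb{F}_q$ that corresponds to a linear $(\delta,\mathcal{H})$-ECIC. Let $i\in[m]$, $\boldsymbol{x}\in\mathbb{F}_q^n$, and let $\boldsymbol{y}_i=\boldsymbol{x}\boldsymbol{L}+\boldsymbol{\epsilon}_i$ be the vector received by receiver $R_i$, where $\boldsymbol{\epsilon}_i\in\mathbb{F}_q^N$ satisfies $\mathsf{wt}(\boldsymbol{\epsilon}_i)\le\delta$. Assume that the syndrome decoding procedure (defined in the context) is applied to $(\boldsymbol{y}_i,\boldsymbol{x}_{\mathcal{X}_i},\boldsymbol{L})$. Then its output satisfies $\hat{x}_{f(i)}=x_{f(i)}$ (for whichever lowest-weight solution $\hat{\boldsymbol{\epsilon}}$ is found in Step 2 and whichever solution $\hat{\boldsymbol{x}}$ is found in Step 3).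
   Context: Notation: $\mathbb{F}_q$ is the finite field with $q$ elements; $[n]=\{1,\dots,n\}$; $\mathsf{wt}$ denotes Hamming weight; for $\boldsymbol{x}\in\mathbb{F}_q^n$ and $B\subseteq[n]$, $\boldsymbol{x}_B$ is the subvector of $\boldsymbol{x}$ indexed by $B$; $\boldsymbol{L}_j$ is the $j$th row of $\boldsymbol{L}$, and $\boldsymbol{L}_B$ is the submatrix of $\boldsymbol{L}$ formed by the rows indexed by $B$. Vectors are row vectors. ICSI instance: integers $m,n\ge 1$, subsets $\mathcal{X}_i\subseteq[n]$ for $i\in[m]$ with $\mathcal{X}=(\mathcal{X}_1,\dots,\mathcal{X}_m)$, and a map $f:[m]\to[n]$ with $f(i)\notin\mathcal{X}_i$ for all $i$. (Receiver $R_i$ knows $\boldsymbol{x}_{\mathcal{X}_i}$ and wants $x_{f(i)}$.) The side information hypergraph $\mathcal{H}(m,n,\mathcal{X},f)$ is the directed hypergraph with vertex set $[n]$ and edges $(f(i),\mathcal{X}_i)$, $i\in[m]$; it represents the instance. Let $\mathcal{Y}_i=[n]\setminus(\{f(i)\}\cup\mathcal{X}_i)$. ECIC: a $\delta$-error-correcting index code ($(\delta,\mathcal{H})$-ECIC) over $\mathbb{F}_q$ of length $N$ is a map $\mathfrak{E}:\mathbb{F}_q^n\to\mathbb{F}_q^N$ such that for each $i\in[m]$ there is a map $\mathfrak{D}_i:\mathbb{F}_q^N\times\mathbb{F}_q^{|\mathcal{X}_i|}\to\mathbb{F}_q$ with $\mathfrak{D}_i(\mathfrak{E}(\boldsymbol{x})+\boldsymbol{\epsilon}_i,\boldsymbol{x}_{\mathcal{X}_i})=x_{f(i)}$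 for all $\boldsymbol{x}\in\mathbb{F}_q^n$ and all $\boldsymbol{\epsilon}_i\in\mathbb{F}_q^N$ with $\mathsf{wt}(\boldsymbol{\epsilon}_i)\le\delta$. An $n\times N$ matrix $\boldsymbol{L}$ corresponds to a linear $(\delta,\mathcal{H})$-ECIC if $\mathfrak{E}(\boldsymbol{x})=\boldsymbol{x}\boldsymbol{L}$ is a $(\delta,\mathcal{H})$-ECIC. Syndrome decoding procedure for $R_i$. Let $\mathscr{C}_i=\mathrm{span}(\{\boldsymbol{L}_{f(i)}\}\cup\{\boldsymbol{L}_j\}_{j\in\mathcal{Y}_i})\subseteq\mathbb{F}_q^N$, and let $\boldsymbol{H}^{(i)}$ be a parity check matrix of $\mathscr{C}_i$ (so $\mathscr{C}_i=\{\boldsymbol{c}\in\mathbb{F}_q^N : \boldsymbol{H}^{(i)}\boldsymbol{c}^T=\boldsymbol{0}\}$). Input: $\boldsymbol{y}_i,\boldsymbol{x}_{\mathcal{X}_i},\boldsymbol{L}$. Step 1: compute the syndrome $\boldsymbol{\beta}_i=\boldsymbol{H}^{(i)}(\boldsymbol{y}_i-\boldsymbol{x}_{\mathcal{X}_i}\boldsymbol{L}_{\mathcal{X}_i})^T$. Step 2: find a solution $\hat{\boldsymbol{\epsilon}}\in\mathbb{F}_q^N$ of lowest Hamming weight of the system $\boldsymbol{H}^{(i)}\hat{\boldsymbol{\epsilon}}^T=\boldsymbol{\beta}_i$. Step 3: given that $\hat{\boldsymbol{x}}_{\mathcal{X}_i}=\boldsymbol{x}_{\mathcal{X}_i}$,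 solve the system $\boldsymbol{y}_i=\hat{\boldsymbol{x}}\boldsymbol{L}+\hat{\boldsymbol{\epsilon}}$ (unknown $\hat{\boldsymbol{x}}\in\mathbb{F}_q^n$) for $\hat{x}_{f(i)}$. Output: $\hat{x}_{f(i)}$. *)

theory Defs
  imports
    "Jordan_Normal_Form.Matrix_Kernel"
    "Jordan_Normal_Form.DL_Submatrix"
    "HOL-Library.FuncSet"
begin

text \<open>
  A finite field \<open>\<bbbF>\<^sub>q\<close> is a type of sort \<open>{field, finite}\<close>. Indices follow the convention of
  \<open>Jordan_Normal_Form\<close>: \<open>[n]\<close> is \<open>{0..<n}\<close>. Row vectors are elements of type \<open>'a vec\<close>.
\<close>

subsection \<open>Vectors over a finite field\<close>

definition hamming_weight :: "'a::zero vec \<Rightarrow> nat" where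
  "hamming_weight v = card {j. j < dim_vec v \<and> v $ j \<noteq> 0}"

text \<open>The subvector indexed by \<open>B\<close>, the vector analogue of \<^const>\<open>submatrix\<close>.\<close>

definition subvec :: "'a vec \<Rightarrow> nat set \<Rightarrow> 'a vec" where
  "subvec x B = vec (card {k. k < dim_vec x \<and> k \<in> B}) (\<lambda>k. x $ pick B k)"

text \<open>The row vector \<open>x A\<close>, obtained as the transpose of \<open>A\<^sup>T x\<^sup>T\<close>.\<close>

definition row_mult :: "'a::semiring_0 vec \<Rightarrow> 'a mat \<Rightarrow> 'a vec" (infixl "\<^sub>v*" 70) where
  "x \<^sub>v* A = transpose_mat A *\<^sub>v x"

subsection \<open>Index coding with side information\<close>

text \<open>
  The hypergraph \<open>\<H>(m, n, \<X>, f)\<close>, with its edges indexed by the receivers: \<open>m\<close>, \<open>n\<close>, \<open>\<X>\<^sub>i\<close>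
  and \<open>f i\<close> are \<open>receivers\<close>, \<open>messages\<close>, \<open>side_info\<close> and \<open>demand\<close>.
\<close>

record side_info_hypergraph =
  receivers :: nat
  messages :: nat
  side_info :: "nat \<Rightarrow> nat set"
  demand :: "nat \<Rightarrow> nat"

definition vertices :: "side_info_hypergraph \<Rightarrow> nat set" where
  "vertices H = {0..<messages H}"

definition edges :: "side_info_hypergraph \<Rightarrow> (nat \<times> nat set) set" where
  "edges H = (\<lambda>i. (demand H i, side_info H i)) ` {0..<receivers H}"

definition icsi_instance :: "side_info_hypergraph \<Rightarrow> bool" where
  "icsi_instance H \<longleftrightarrow> receivers H \<ge> 1 \<and> messages H \<ge> 1 \<and>
     (\<forall>(v, B) \<in> edges H. v \<in> vertices H \<and> B \<subseteq> vertices H \<and> v \<notin> B)"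

text \<open>The set \<open>\<Y>\<^sub>i\<close> of messages that the receiver neither demands nor knows.\<close>

definition interference :: "side_info_hypergraph \<Rightarrow> nat \<Rightarrow> nat set" where
  "interference H i = vertices H - ({demand H i} \<union> side_info H i)"

definition is_ecic ::
    "nat \<Rightarrow> side_info_hypergraph \<Rightarrow> nat \<Rightarrow> ('a::{field,finite} vec \<Rightarrow> 'a vec) \<Rightarrow> bool" where
  "is_ecic \<delta> H N E \<longleftrightarrow>
     E \<in> carrier_vec (messages H) \<rightarrow> carrier_vec N \<and>
     (\<forall>i < receivers H. \<exists>D :: 'a vec \<Rightarrow> 'a vec \<Rightarrow> 'a.
        \<forall>x \<in> carrier_vec (messages H). \<forall>e \<in> carrier_vec N.
          hamming_weight e \<le> \<delta> \<longrightarrow> D (E x + e) (subvec x (side_info H i)) = x $ demand H i)"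

definition is_linear_ecic ::
    "nat \<Rightarrow> side_info_hypergraph \<Rightarrow> nat \<Rightarrow> 'a::{field,finite} mat \<Rightarrow> bool" where
  "is_linear_ecic \<delta> H N L \<longleftrightarrow>
     L \<in> carrier_mat (messages H) N \<and> is_ecic \<delta> H N (\<lambda>x. x \<^sub>v* L)"

subsection \<open>Syndrome decoding\<close>

definition receiver_code ::
    "side_info_hypergraph \<Rightarrow> nat \<Rightarrow> 'a::{field,finite} mat \<Rightarrow> 'a vec set" where
  "receiver_code H i L =
     LinearCombinations.module.span class_ring (module_vec TYPE('a) (dim_col L))
       ({row L (demand H i)} \<union> row L ` interference H i)"

text \<open>The rows of a parity check matrix are not required to be linearly independent.\<close>

definition is_parity_check :: "nat \<Rightarrow> 'a::field mat \<Rightarrow> 'a vec set \<Rightarrow> bool" where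
  "is_parity_check N P C \<longleftrightarrow> dim_col P = N \<and> C = mat_kernel P"

text \<open>
  In the three steps below, \<open>P\<close> is the parity check matrix, \<open>y\<close> the received vector and \<open>s\<close> the
  side information of receiver \<open>i\<close>. Steps 2 and 3 are nondeterministic and given as predicates on
  the solution found.
\<close>

definition syndrome ::
    "side_info_hypergraph \<Rightarrow> nat \<Rightarrow> 'a::field mat \<Rightarrow> 'a mat \<Rightarrow> 'a vec \<Rightarrow> 'a vec \<Rightarrow> 'a vec" where
  "syndrome H i L P y s = P *\<^sub>v (y - s \<^sub>v* submatrix L (side_info H i) UNIV)"

definition error_estimate ::
    "side_info_hypergraph \<Rightarrow> nat \<Rightarrow> 'a::field mat \<Rightarrow> 'a mat \<Rightarrow> 'a vec \<Rightarrow> 'a vec \<Rightarrow> 'a vec \<Rightarrow> bool"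
where
  "error_estimate H i L P y s e \<longleftrightarrow>
     is_arg_min hamming_weight
       (\<lambda>e. e \<in> carrier_vec (dim_col L) \<and> P *\<^sub>v e = syndrome H i L P y s) e"

definition message_estimate ::
    "side_info_hypergraph \<Rightarrow> nat \<Rightarrow> 'a::field mat \<Rightarrow> 'a vec \<Rightarrow> 'a vec \<Rightarrow> 'a vec \<Rightarrow> 'a vec \<Rightarrow> bool"
where
  "message_estimate H i L y s e z \<longleftrightarrow>
     z \<in> carrier_vec (messages H) \<and> subvec z (side_info H i) = s \<and> y = z \<^sub>v* L + e"

end

theory Submission
  imports Defs
begin

text \<open>
  Let \<open>r = y - s L\<^sub>X\<close> and let \<open>B\<close> be the complement of \<open>X = \<X>\<^sub>i\<close>. The code \<open>\<C>\<^sub>i = ker P\<close> is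
  the row space of \<open>L\<^sub>B\<close>, so \<open>e\<close> has the syndrome of \<open>r\<close> iff \<open>r - e = t L\<^sub>B\<close> for some \<open>t\<close>, that is,
  iff \<open>y = z L + e\<close> for the \<open>z\<close> that agrees with \<open>s\<close> on \<open>X\<close> and with \<open>t\<close> on \<open>B\<close>. The true error is such
  an \<open>e\<close>, so one of minimal weight has weight at most \<open>\<delta>\<close>, and the decoding function of the code sees
  the same input for \<open>(z, e)\<close> as for \<open>(x, \<epsilon>)\<close>.
\<close>

section \<open>Subvectors, row submatrices and splitting a row vector product\<close>

lemma vec_diff_eq_iff:
  fixes u v w :: "'a::ab_group_add vec"
  assumes "u \<in> carrier_vec n" "v \<in> carrier_vec n" "w \<in> carrier_vec n"
  shows "u - v = w \<longleftrightarrow> u = w + v"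
  using assms by (auto simp: vec_eq_iff algebra_simps)

text \<open>The inverse of \<open>pick S\<close> is the rank map, counting the elements of
  \<open>S\<close> below a given one. It turns sums over the positions of a subvector into sums over
  the index set.\<close>

lemma bij_betw_pick:
  assumes "finite S"
  shows "bij_betw (pick S) {..<card S} S"
proof (rule bij_betw_byWitness[where f' = "\<lambda>i. card {a \<in> S. a < i}"])
  show "\<forall>k\<in>{..<card S}. card {a \<in> S. a < pick S k} = k"
    by (simp add: card_pick_le)
  show "\<forall>i\<in>S. pick S (card {a \<in> S. a < i}) = i"
    by (simp add: pick_card_in_set)
  show "pick S ` {..<card S} \<subseteq> S"
    by (auto simp: pick_in_set_le)
  have "card {a \<in> S. a < i} < card S" if "i \<in> S" for i
    using assms that by (intro psubset_card_mono) auto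
  then show "(\<lambda>i. card {a \<in> S. a < i}) ` S \<subseteq> {..<card S}"
    by auto
qed

lemma Collect_less_mem: "B \<subseteq> {0..<n} \<Longrightarrow> {k. k < n \<and> k \<in> B} = B"
  by auto

lemma dim_subvec [simp]: "B \<subseteq> {0..<dim_vec x} \<Longrightarrow> dim_vec (subvec x B) = card B"
  by (simp add: subvec_def Collect_less_mem)

lemma subvec_carrier:
  assumes "x \<in> carrier_vec n" "B \<subseteq> {0..<n}"
  shows "subvec x B \<in> carrier_vec (card B)"
  using assms by (intro carrier_vecI) simp

lemma index_subvec:
  "B \<subseteq> {0..<dim_vec x} \<Longrightarrow> k < card B \<Longrightarrow> subvec x B $ k = x $ pick B k"
  by (simp add: subvec_def Collect_less_mem)

lemma submatrix_rows_carrier: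
  "L \<in> carrier_mat n N \<Longrightarrow> B \<subseteq> {0..<n} \<Longrightarrow> submatrix L B UNIV \<in> carrier_mat (card B) N"
  by (intro carrier_matI) (simp_all add: dim_submatrix Collect_less_mem)

lemma index_submatrix_rows:
  assumes "L \<in> carrier_mat n N" "B \<subseteq> {0..<n}" "k < card B" "j < N"
  shows "submatrix L B UNIV $$ (k, j) = L $$ (pick B k, j)"
  using assms by (simp add: submatrix_index Collect_less_mem pick_UNIV)

lemma row_mult_carrier [simp]: "L \<in> carrier_mat n N \<Longrightarrow> x \<^sub>v* L \<in> carrier_vec N"
  by (intro carrier_vecI) (simp add: row_mult_def)

lemma index_row_mult:
  assumes "L \<in> carrier_mat n N" "x \<in> carrier_vec n" "j < N"
  shows "(x \<^sub>v* L) $ j = (\<Sum>k<n. L $$ (k, j) * x $ k)"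
  using assms by (auto simp: row_mult_def scalar_prod_def atLeast0LessThan intro!: sum.cong)

text \<open>Reindexing along \<open>pick\<close> removes positions from the formula: the sum runs
  over the original indices, so complementary index sets can be combined by adding sums.\<close>

lemma index_row_mult_submatrix:
  assumes L: "L \<in> carrier_mat n N" and x: "x \<in> carrier_vec n" and B: "B \<subseteq> {0..<n}" and j: "j < N"
  shows "(subvec x B \<^sub>v* submatrix L B UNIV) $ j = (\<Sum>k\<in>B. L $$ (k, j) * x $ k)"
proof -
  have fin: "finite B"
    using B finite_subset by blast
  note carr = subvec_carrier[OF x B]
  have "(subvec x B \<^sub>v* submatrix L B UNIV) $ j
      = (\<Sum>k<card B. L $$ (pick B k, j) * x $ pick B k)"
    unfolding index_row_mult[OF submatrix_rows_carrier[OF L B] carr j]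
    using x L B j by (intro sum.cong) (auto simp: index_submatrix_rows index_subvec)
  also have "\<dots> = (\<Sum>k\<in>B. L $$ (k, j) * x $ k)"
    by (rule sum.reindex_bij_betw[OF bij_betw_pick[OF fin]])
  finally show ?thesis .
qed

text \<open>In each column, the sum over all messages splits into the sums over \<open>B\<close> and
  its complement. With \<open>B\<close> the side information, the first summand is what the receiver
  can subtract.\<close>

lemma row_mult_split:
  assumes L: "L \<in> carrier_mat n N" and x: "x \<in> carrier_vec n" and B: "B \<subseteq> {0..<n}"
  shows "x \<^sub>v* L = subvec x B \<^sub>v* submatrix L B UNIV
    + subvec x ({0..<n} - B) \<^sub>v* submatrix L ({0..<n} - B) UNIV"
    (is "_ = ?u + ?v")
proof (rule eq_vecI)
  have uv: "?u \<in> carrier_vec N" "?v \<in> carrier_vec N"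
    using L B by (auto intro!: row_mult_carrier submatrix_rows_carrier)
  have xL: "x \<^sub>v* L \<in> carrier_vec N"
    using L by simp
  show "dim_vec (x \<^sub>v* L) = dim_vec (?u + ?v)"
    using uv xL by simp
  fix j assume "j < dim_vec (?u + ?v)"
  then have j: "j < N"
    using uv by simp
  have "(\<Sum>k<n. L $$ (k, j) * x $ k) =
      (\<Sum>k\<in>{0..<n} - B. L $$ (k, j) * x $ k) + (\<Sum>k\<in>B. L $$ (k, j) * x $ k)"
    using B by (simp add: lessThan_atLeast0 sum.subset_diff)
  then show "(x \<^sub>v* L) $ j = (?u + ?v) $ j"
    using uv j index_row_mult[OF L x j] index_row_mult_submatrix[OF L x B j]
      index_row_mult_submatrix[OF L x Diff_subset j, of B]
    by (simp add: add.commute)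
qed

section \<open>The receiver code as a row space\<close>

lemma rows_submatrix:
  assumes L: "L \<in> carrier_mat n N" and B: "B \<subseteq> {0..<n}"
  shows "set (rows (submatrix L B UNIV)) = row L ` B"
proof -
  have fin: "finite B"
    using B finite_subset by blast
  have "row (submatrix L B UNIV) k = row L (pick B k)" if k: "k < card B" for k
  proof (rule eq_vecI)
    have p: "pick B k < n"
      using pick_in_set_le[OF k] B by auto
    show "dim_vec (row (submatrix L B UNIV) k) = dim_vec (row L (pick B k))"
      using submatrix_rows_carrier[OF L B] L by simp
    fix j assume "j < dim_vec (row L (pick B k))"
    then show "row (submatrix L B UNIV) k $ j = row L (pick B k) $ j"
      using L k p submatrix_rows_carrier[OF L B] by (simp add: index_submatrix_rows[OF L B])
  qed
  then have "set (rows (submatrix L B UNIV)) = row L ` pick B ` {..<card B}"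
    using submatrix_rows_carrier[OF L B]
    by (auto simp: rows_def lessThan_atLeast0 image_image)
  then show ?thesis
    using bij_betw_imp_surj_on[OF bij_betw_pick[OF fin]] by simp
qed

text \<open>A span depends only on the set of generators, so \<open>rows_submatrix\<close> makes it
  the row space of the submatrix. That is the image of the transpose, which is how
  \<open>row_mult\<close> is defined.\<close>

lemma span_rows_eq_range:
  fixes L :: "'a::field mat"
  assumes L: "L \<in> carrier_mat n N" and B: "B \<subseteq> {0..<n}"
  shows "LinearCombinations.module.span class_ring (module_vec TYPE('a) N) (row L ` B)
    = (\<lambda>t. t \<^sub>v* submatrix L B UNIV) ` carrier_vec (card B)"
proof -
  interpret vec_space "TYPE('a)" N .
  have "span (row L ` B) = row_space (submatrix L B UNIV)"
    by (simp add: row_space_def rows_submatrix[OF L B])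
  then show ?thesis
    using row_space_eq[OF submatrix_rows_carrier[OF L B]] submatrix_rows_carrier[OF L B]
    by (auto simp: row_mult_def)
qed

lemma receiver_code_eq_range:
  assumes "icsi_instance H" "i < receivers H" "L \<in> carrier_mat (messages H) N"
  defines "B \<equiv> {0..<messages H} - side_info H i"
  shows "receiver_code H i L = (\<lambda>t. t \<^sub>v* submatrix L B UNIV) ` carrier_vec (card B)"
proof -
  \<comment> \<open>The demand is a vertex outside the side information, so adding it to the
    interference gives exactly the complement of the side information.\<close>
  have "insert (demand H i) (interference H i) = B"
    using assms(1,2) by (auto simp: icsi_instance_def edges_def vertices_def interference_def B_def)
  then have "{row L (demand H i)} \<union> row L ` interference H i = row L ` B"
    by blast
  then show ?thesis
    using span_rows_eq_range[OF assms(3), of B] assms(3) by (simp add: receiver_code_def B_def)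
qed

section \<open>Gluing vectors along complementary index sets\<close>

lemma exists_vec_with_subvecs:
  assumes x: "x \<in> carrier_vec n" and A: "A \<subseteq> {0..<n}"
    and t: "t \<in> carrier_vec (card ({0..<n} - A))"
  shows "\<exists>z\<in>carrier_vec n. subvec z A = subvec x A \<and> subvec z ({0..<n} - A) = t"
proof -
  define B where "B = {0..<n} - A"
  \<comment> \<open>Entries on \<open>A\<close> are copied from \<open>x\<close>. An index outside
    \<open>A\<close> is looked up in \<open>t\<close> at its rank in \<open>B\<close>, which inverts
    \<open>pick B\<close>.\<close>
  define z where "z = vec n (\<lambda>j. if j \<in> A then x $ j else t $ card {a \<in> B. a < j})"
  have pickA: "pick A k < n" "pick A k \<in> A" if "k < card A" for k
    using pick_in_set_le[OF that] A by auto
  have pickB: "pick B k < n" "pick B k \<notin> A" if "k < card B" for k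
    using pick_in_set_le[OF that] by (auto simp: B_def)
  have "subvec z A = subvec x A"
    using x A by (intro eq_vecI) (auto simp: index_subvec z_def pickA)
  moreover have "subvec z B = t"
  proof (rule eq_vecI)
    have BZ: "B \<subseteq> {0..<dim_vec z}"
      by (auto simp: B_def z_def)
    then show "dim_vec (subvec z B) = dim_vec t"
      using t by (simp add: B_def)
    fix k assume "k < dim_vec t"
    then have "k < card B"
      using t by (simp add: B_def)
    then show "subvec z B $ k = t $ k"
      by (simp add: index_subvec[OF BZ], simp add: z_def pickB card_pick_le)
  qed
  ultimately show ?thesis
    by (intro bexI[of _ z]) (auto simp: z_def B_def)
qed

section \<open>Correctness of syndrome decoding\<close>

theorem mainTheorem6:
  fixes H :: side_info_hypergraph
    and \<delta> N i :: nat
    and L P :: "'a::{field,finite} mat"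
    and x \<epsilon> y s :: "'a vec"
  assumes "icsi_instance H"
    and "is_linear_ecic \<delta> H N L"
    and "i < receivers H"
    and "is_parity_check N P (receiver_code H i L)"
    and "x \<in> carrier_vec (messages H)"
    and "\<epsilon> \<in> carrier_vec N"
    and "hamming_weight \<epsilon> \<le> \<delta>"
    and "y = x \<^sub>v* L + \<epsilon>"
    and "s = subvec x (side_info H i)"
  shows "(\<exists>e. error_estimate H i L P y s e) \<and>
         (\<forall>e. error_estimate H i L P y s e \<longrightarrow>
            (\<exists>z. message_estimate H i L y s e z) \<and>
            (\<forall>z. message_estimate H i L y s e z \<longrightarrow> z $ demand H i = x $ demand H i))"
proof -
  define n where "n = messages H"
  define X where "X = side_info H i"
  define B where "B = {0..<n} - X"
  define LX where "LX = submatrix L X UNIV"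
  define LB where "LB = submatrix L B UNIV"
  have L: "L \<in> carrier_mat n N" and ecic: "is_ecic \<delta> H N (\<lambda>x. x \<^sub>v* L)"
    using assms(2) by (auto simp: is_linear_ecic_def n_def)
  have x: "x \<in> carrier_vec n"
    using assms(5) by (simp add: n_def)
  have X: "X \<subseteq> {0..<n}"
    using assms(1,3) by (auto simp: icsi_instance_def edges_def vertices_def X_def n_def)
  have LX: "LX \<in> carrier_mat (card X) N" and LB: "LB \<in> carrier_mat (card B) N"
    unfolding LX_def LB_def by (rule submatrix_rows_carrier[OF L], use X in \<open>auto simp: B_def\<close>)+
  have split: "z \<^sub>v* L = subvec z X \<^sub>v* LX + subvec z B \<^sub>v* LB" if "z \<in> carrier_vec n" for z
    using row_mult_split[OF L that X] by (simp add: LX_def LB_def B_def)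
  have kernel: "mat_kernel P = (\<lambda>t. t \<^sub>v* LB) ` carrier_vec (card B)"
    using assms(4) receiver_code_eq_range[OF assms(1,3), of L N] L
    by (simp add: is_parity_check_def n_def X_def B_def LB_def)
  have P: "P \<in> carrier_mat (dim_row P) N"
    using assms(4) by (intro carrier_matI) (simp_all add: is_parity_check_def)

  define r where "r = y - s \<^sub>v* LX"
  have sLX: "s \<^sub>v* LX \<in> carrier_vec N"
    using LX by simp
  have y: "y \<in> carrier_vec N"
    using assms(6,8) L by simp
  have r: "r \<in> carrier_vec N"
    using y sLX by (simp add: r_def)
  have estimate_iff: "error_estimate H i L P y s e \<longleftrightarrow>
      is_arg_min hamming_weight (\<lambda>e. e \<in> carrier_vec N \<and> P *\<^sub>v e = P *\<^sub>v r) e" for e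
    using L by (simp add: error_estimate_def syndrome_def r_def LX_def X_def)
  have coset: "P *\<^sub>v e = P *\<^sub>v r \<longleftrightarrow> (\<exists>t\<in>carrier_vec (card B). r = t \<^sub>v* LB + e)"
    if e: "e \<in> carrier_vec N" for e
  proof -
    have "P *\<^sub>v (r - e) = P *\<^sub>v r - P *\<^sub>v e"
      by (rule mult_minus_distrib_mat_vec[OF P r e])
    moreover have "P *\<^sub>v r - P *\<^sub>v e = 0\<^sub>v (dim_row P) \<longleftrightarrow> P *\<^sub>v r = 0\<^sub>v (dim_row P) + P *\<^sub>v e"
      by (rule vec_diff_eq_iff[OF mult_mat_vec_carrier[OF P r] mult_mat_vec_carrier[OF P e] zero_carrier_vec])
    ultimately have "P *\<^sub>v e = P *\<^sub>v r \<longleftrightarrow> P *\<^sub>v (r - e) = 0\<^sub>v (dim_row P)"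
      using left_zero_vec[OF mult_mat_vec_carrier[OF P e]] by metis
    also have "\<dots> \<longleftrightarrow> r - e \<in> mat_kernel P"
      using minus_carrier_vec[OF r e] by (simp add: mat_kernel[OF P])
    also have "\<dots> \<longleftrightarrow> (\<exists>t\<in>carrier_vec (card B). r - e = t \<^sub>v* LB)"
      by (auto simp: kernel)
    also have "\<dots> \<longleftrightarrow> (\<exists>t\<in>carrier_vec (card B). r = t \<^sub>v* LB + e)"
    proof (rule bex_cong[OF refl])
      fix t
      have "t \<^sub>v* LB \<in> carrier_vec N"
        using LB by simp
      then show "r - e = t \<^sub>v* LB \<longleftrightarrow> r = t \<^sub>v* LB + e"
        using r e by (intro vec_diff_eq_iff[of _ N])
    qed
    finally show ?thesis .
  qed

  \<comment> \<open>The side information is the true \<open>subvec x X\<close>, so subtracting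
    \<open>s \<^sub>v* LX\<close> cancels the contribution of \<open>X\<close> exactly. What remains
    fits \<open>coset\<close> with \<open>subvec x B\<close> as the coefficient vector.\<close>
  have sol: "P *\<^sub>v \<epsilon> = P *\<^sub>v r"
  proof -
    have xBc: "subvec x B \<in> carrier_vec (card B)"
      using subvec_carrier[OF x, of B] by (simp add: B_def)
    have xB: "subvec x B \<^sub>v* LB \<in> carrier_vec N"
      using LB by simp
    have "y = s \<^sub>v* LX + subvec x B \<^sub>v* LB + \<epsilon>"
      using assms(8,9) split[OF x] by (simp add: X_def)
    also have "\<dots> = subvec x B \<^sub>v* LB + \<epsilon> + s \<^sub>v* LX"
      using sLX xB assms(6)
      by (metis add_carrier_vec assoc_add_vec comm_add_vec)
    finally have "r = subvec x B \<^sub>v* LB + \<epsilon>"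
      unfolding r_def using y sLX xB assms(6) by (subst vec_diff_eq_iff[of _ N]) simp_all
    then show ?thesis
      using coset[OF assms(6)] xBc by blast
  qed

  \<comment> \<open>The system of Step 2 is solvable by \<open>sol\<close>, and weights are natural
    numbers, so some solution attains the least one.\<close>
  have "\<exists>e. error_estimate H i L P y s e"
  proof -
    have "\<exists>e. (e \<in> carrier_vec N \<and> P *\<^sub>v e = P *\<^sub>v r) \<and>
        (\<forall>e'. e' \<in> carrier_vec N \<and> P *\<^sub>v e' = P *\<^sub>v r \<longrightarrow> hamming_weight e \<le> hamming_weight e')"
      using sol assms(6) by (intro ex_has_least_nat) blast
    then show ?thesis
      by (auto simp: estimate_iff is_arg_min_def not_less)
  qed
  moreover have "(\<exists>z. message_estimate H i L y s e z) \<and>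
      (\<forall>z. message_estimate H i L y s e z \<longrightarrow> z $ demand H i = x $ demand H i)"
    if est: "error_estimate H i L P y s e" for e
  proof
    have e: "e \<in> carrier_vec N" and Pe: "P *\<^sub>v e = P *\<^sub>v r"
      using est by (auto simp: estimate_iff is_arg_min_def)
    \<comment> \<open>By \<open>sol\<close> the true error competes in the minimisation, which
      brings \<open>e\<close> within the weight bound that the code tolerates.\<close>
    have "hamming_weight e \<le> hamming_weight \<epsilon>"
      using est sol assms(6) by (auto simp: estimate_iff is_arg_min_def not_less)
    then have weight: "hamming_weight e \<le> \<delta>"
      using assms(7) by simp
    obtain t where t: "t \<in> carrier_vec (card B)" and r_eq: "r = t \<^sub>v* LB + e"
      using coset[OF e] Pe by blast
    \<comment> \<open>A solution for Step 3: \<open>t\<close> supplies the unknown entries and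
      \<open>x\<close> those on \<open>X\<close>, where it agrees with \<open>s\<close>.\<close>
    obtain z where z: "z \<in> carrier_vec n" "subvec z X = s" "subvec z B = t"
      using exists_vec_with_subvecs[OF x X] t assms(9) by (auto simp: B_def X_def)
    have tLB: "t \<^sub>v* LB \<in> carrier_vec N"
      using LB by simp
    have "y = t \<^sub>v* LB + e + s \<^sub>v* LX"
      using r_eq y sLX tLB e unfolding r_def by (subst (asm) vec_diff_eq_iff[of _ N]) simp_all
    also have "\<dots> = s \<^sub>v* LX + t \<^sub>v* LB + e"
      using sLX tLB e by (metis add_carrier_vec assoc_add_vec comm_add_vec)
    finally have "y = z \<^sub>v* L + e"
      by (simp add: split[OF z(1)] z(2,3))
    then show "\<exists>z. message_estimate H i L y s e z"
      using z by (auto simp: message_estimate_def n_def X_def)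

    \<comment> \<open>One \<open>D\<close> serves all messages and errors, so its value is
      determined by the received vector and the side information alone.\<close>
    obtain D where D: "\<And>x e. x \<in> carrier_vec n \<Longrightarrow> e \<in> carrier_vec N \<Longrightarrow> hamming_weight e \<le> \<delta>
        \<Longrightarrow> D (x \<^sub>v* L + e) (subvec x X) = x $ demand H i"
      using ecic assms(3) unfolding is_ecic_def n_def X_def by metis
    show "\<forall>z. message_estimate H i L y s e z \<longrightarrow> z $ demand H i = x $ demand H i"
    proof (intro allI impI)
      fix z assume "message_estimate H i L y s e z"
      then have z: "z \<in> carrier_vec n" "subvec z X = s" "y = z \<^sub>v* L + e"
        by (auto simp: message_estimate_def n_def X_def)
      \<comment> \<open>Now \<open>z\<close> is an arbitrary solution of Step 3. The pairs
        \<open>(z, e)\<close> and \<open>(x, \<epsilon>)\<close> both present \<open>D\<close> with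
        \<open>y\<close> and \<open>s\<close>, so the demanded entries agree even if
        \<open>e\<close> differs from \<open>\<epsilon>\<close>.\<close>
      have "z $ demand H i = D y s"
        using D[OF z(1) e weight] z(2,3) by simp
      also have "\<dots> = x $ demand H i"
        using D[OF x assms(6,7)] assms(8,9) by (simp add: X_def)
      finally show "z $ demand H i = x $ demand H i" .
    qed
  qed
  ultimately show ?thesis
    by blast
qed

end
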